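(* Let $G=(V,E)$ be a finite connected loopless graph with integer edge lengths $\ell\colon E\to\mathbb{Z}_{>0}$. The polytopes $\mathrm{Vor}_H(f)$, for $f\in C^0(G,\mathbb{Z})$ with $G_f$ connected, are the top-dimensional cells of a tiling $\mathrm{Vor}_{G,\ell}$ of $H_{0,\mathbb{R}}$ by polytopes. Each top-dimensional cell is congruent to the Voronoi cell of a connected subgraph of $G$; more precisely, $\mathrm{Vor}_H(f)$ is congruent to $\mathrm{Vor}_{G_f}(O)$ for each $f\in C^0(G,\mathbb{Z})$ with $G_f$ connected.
   Context: $\mathbb{E}$: oriented edges ($e=uv$: tail $u$, head $v$); $\ell_{\bar e}=\ell_e$. $C^0(G,A)$ = functions $V\to A$; $C^1(G,A)$ = $x\colon\mathbb{E}\to A$ with $x_{\bar e}=-x_e$; $d^*\colon C^1(G,\mathbb{R})\to C^0(G,\mathbb{R})$, $d^*(x)(v)=\sum_{e:\ \mathrm{head}(e)=v}x_e$; $H_{0,\mathbb{R}}=\{f\in C^0(G,\mathbb{R}):\sum_vf(v)=0\}$. For $f\in C^0(G,\mathbb{Z})$ and $e=uv$: $\mathfrak{d}_f(e)=(f(v)-f(u))/\ell_e$ if $\ell_e\mid f(v)-f(u)$, and $\mathfrak{d}_f(e)=\lfloor (f(v)-f(u))/\ell_e\rfloor+\frac12$ otherwise. $G_f$ is the spanning subgraph whose edges are those $e$ with $\ell_e\mid f(v)-f(u)$. $\square_f=\{\mathfrak{d}_f+\epsilon:\epsilon\in C^1(G,\mathbb{R}),\ |\epsilon_e|\le\frac12\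 \forall e,\ \epsilon_e=0\text{ for } e\notin G_f\}$ and $\mathrm{Vor}_H(f):=d^*(\square_f)$. For a connected spanning subgraph $G'$ (so $C^0(G',\mathbb{R})=C^0(G,\mathbb{R})$), $\mathrm{Vor}_{G'}(O)$ is the Voronoi cell of the origin in $H_{0,\mathbb{R}}$ with respect to the lattice $\Lambda_\mathbb{Z}(G')=d'^*d'(C^0(G',\mathbb{Z}))$ and the quadratic form $q'(h)=\langle f,\Delta' f\rangle$ ($\Delta'f=h$), where $d',d'^*,\Delta'=d'^*d'$ are the coboundary, its adjoint and the Laplacian of $G'$. A tiling of $H_{0,\mathbb{R}}$ is a family of polytopes covering it, closed under taking faces, any two of which intersect in a common face or not at all. *)

theory Defs
  imports
    "HOL-Analysis.Analysis"
    "Graph_Theory.Bidirected_Digraph"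
    "Graph_Theory.Digraph_Component"
begin

text \<open>
  A finite graph, possibly with parallel edges, is a bidirected digraph with arc set the set of
  oriented edges and with \<open>arev\<close> reversing the orientation. The vertex set is the universe of
  a finite type, so that real 0-cochains form the Euclidean space \<^typ>\<open>real^'v\<close>.
\<close>

text \<open>Cochains of degree 1 are extended by 0 outside the set of oriented edges.\<close>

definition cochains1 :: "('v, 'e) pre_digraph \<Rightarrow> ('e \<Rightarrow> 'e) \<Rightarrow> ('e \<Rightarrow> real) set" where
  "cochains1 G arev =
     {x. (\<forall>e\<in>arcs G. x (arev e) = - x e) \<and> (\<forall>e. e \<notin> arcs G \<longrightarrow> x e = 0)}"

definition coboundary :: "('v::finite, 'e) pre_digraph \<Rightarrow> real^'v \<Rightarrow> 'e \<Rightarrow> real" where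
  "coboundary G f e = (if e \<in> arcs G then f $ head G e - f $ tail G e else 0)"

definition coboundary_adj :: "('v::finite, 'e) pre_digraph \<Rightarrow> ('e \<Rightarrow> real) \<Rightarrow> real^'v" where
  "coboundary_adj G x = (\<chi> v. \<Sum>e\<in>in_arcs G v. x e)"

definition laplacian :: "('v::finite, 'e) pre_digraph \<Rightarrow> real^'v \<Rightarrow> real^'v" where
  "laplacian G f = coboundary_adj G (coboundary G f)"

definition H0 :: "(real^'v::finite) set" where
  "H0 = {f. (\<Sum>v\<in>UNIV. f $ v) = 0}"

definition laplacian_lattice :: "('v::finite, 'e) pre_digraph \<Rightarrow> (real^'v) set" where
  "laplacian_lattice G = range (\<lambda>f :: 'v \<Rightarrow> int. laplacian G (\<chi> v. real_of_int (f v)))"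

text \<open>For connected \<open>G\<close> and \<open>h \<in> H0\<close> the preimage \<open>f\<close> of \<open>h\<close> exists and is unique up to
  an additive constant, which does not affect the value.\<close>

definition laplacian_form :: "('v::finite, 'e) pre_digraph \<Rightarrow> real^'v \<Rightarrow> real" where
  "laplacian_form G h = (THE r. \<exists>f. laplacian G f = h \<and> r = f \<bullet> laplacian G f)"

definition voronoi_cell_origin ::
    "'a::real_vector set \<Rightarrow> 'a set \<Rightarrow> ('a \<Rightarrow> real) \<Rightarrow> 'a set" where
  "voronoi_cell_origin S L q = {h \<in> S. \<forall>\<mu>\<in>L. q h \<le> q (h - \<mu>)}"

definition VorO :: "('v::finite, 'e) pre_digraph \<Rightarrow> (real^'v) set" where
  "VorO G = voronoi_cell_origin H0 (laplacian_lattice G) (laplacian_form G)"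

definition slope ::
    "('v, 'e) pre_digraph \<Rightarrow> ('e \<Rightarrow> int) \<Rightarrow> ('v \<Rightarrow> int) \<Rightarrow> 'e \<Rightarrow> real" where
  "slope G l f e =
     (if e \<notin> arcs G then 0
      else if l e dvd f (head G e) - f (tail G e)
      then real_of_int (f (head G e) - f (tail G e)) / real_of_int (l e)
      else real_of_int \<lfloor>real_of_int (f (head G e) - f (tail G e)) / real_of_int (l e)\<rfloor> + 1 / 2)"

definition divisible_subgraph ::
    "('v, 'e) pre_digraph \<Rightarrow> ('e \<Rightarrow> int) \<Rightarrow> ('v \<Rightarrow> int) \<Rightarrow> ('v, 'e) pre_digraph" where
  "divisible_subgraph G l f =
     \<lparr> verts = verts G, arcs = {e \<in> arcs G. l e dvd f (head G e) - f (tail G e)},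
       tail = tail G, head = head G \<rparr>"

definition cube ::
    "('v, 'e) pre_digraph \<Rightarrow> ('e \<Rightarrow> 'e) \<Rightarrow> ('e \<Rightarrow> int) \<Rightarrow> ('v \<Rightarrow> int) \<Rightarrow> ('e \<Rightarrow> real) set" where
  "cube G arev l f =
     {\<lambda>e. slope G l f e + \<epsilon> e | \<epsilon>. \<epsilon> \<in> cochains1 G arev \<and> (\<forall>e\<in>arcs G. \<bar>\<epsilon> e\<bar> \<le> 1 / 2) \<and>
        (\<forall>e\<in>arcs G. e \<notin> arcs (divisible_subgraph G l f) \<longrightarrow> \<epsilon> e = 0)}"

definition VorH ::
    "('v::finite, 'e) pre_digraph \<Rightarrow> ('e \<Rightarrow> 'e) \<Rightarrow> ('e \<Rightarrow> int) \<Rightarrow> ('v \<Rightarrow> int) \<Rightarrow> (real^'v) set" where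
  "VorH G arev l f = coboundary_adj G ` cube G arev l f"

text \<open>Cells are nonempty; \<open>face_of\<close> admits the empty face, which is therefore excluded.\<close>

definition polytope_tiling :: "'a::euclidean_space set set \<Rightarrow> 'a set \<Rightarrow> bool" where
  "polytope_tiling T S \<longleftrightarrow>
     (\<forall>P\<in>T. polytope P \<and> P \<noteq> {}) \<and>
     \<Union>T = S \<and>
     (\<forall>P\<in>T. \<forall>F. F face_of P \<and> F \<noteq> {} \<longrightarrow> F \<in> T) \<and>
     (\<forall>P\<in>T. \<forall>Q\<in>T. P \<inter> Q \<noteq> {} \<longrightarrow> P \<inter> Q face_of P \<and> P \<inter> Q face_of Q)"

definition top_cells :: "'a::euclidean_space set set \<Rightarrow> 'a set \<Rightarrow> 'a set set" where
  "top_cells T S = {P \<in> T. aff_dim P = aff_dim S}"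

definition Vor_tiling ::
    "('v::finite, 'e) pre_digraph \<Rightarrow> ('e \<Rightarrow> 'e) \<Rightarrow> ('e \<Rightarrow> int) \<Rightarrow> (real^'v) set set" where
  "Vor_tiling G arev l =
     {F. F \<noteq> {} \<and>
         (\<exists>f. Digraph_Component.connected (divisible_subgraph G l f) \<and> F face_of VorH G arev l f)}"

text \<open>Congruence is by translation: no metric is singled out, as the quadratic forms of \<open>G\<close> and
  of its subgraphs differ, and a translate is congruent for each of them.\<close>

definition translation_congruent :: "'a::real_vector set \<Rightarrow> 'a set \<Rightarrow> bool" where
  "translation_congruent P Q \<longleftrightarrow> (\<exists>c. P = (\<lambda>x. c + x) ` Q)"

end

theory Submission
  imports Defs
begin

text \<open>
  The cells are the subdifferentials of a convex piecewise linear function. For an edge of length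
  \<open>l\<close> let \<open>\<phi>\<close> interpolate \<open>t\<^sup>2 / (2 * l)\<close> linearly between consecutive multiples of \<open>l\<close>, and let
  \<open>\<Phi>(g)\<close> be the sum of the \<open>\<phi>\<close>-values of the differences of \<open>g\<close> along the edges. Then \<open>VorH f\<close> consists of
  the \<open>h\<close> for which \<open>f\<close> maximises the gain \<open>g \<bullet> h - \<Phi>(g)\<close> over all real \<open>g\<close>: one inclusion is
  the subgradient inequality on each edge, the other one separates \<open>h\<close> from the polytope \<open>VorH f\<close>.
  Hence two cells meet where two affine functions agree, that is, in a common exposed face.

  For the covering, let \<open>h \<in> H0\<close>. As long as the edges with divisible difference do not
  connect the graph, \<open>g\<close> can be shifted along a cut without decreasing the gain until one more edge
  becomes divisible; so every gain is bounded by that of an integral \<open>f\<close> with \<open>G\<^sub>f\<close> connected,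
  and the nonnegative ones of the latter form a finite set. Finally both \<open>VorH f\<close> and \<open>VorO G\<^sub>f\<close> are
  translates of the graphical zonotope of \<open>G\<^sub>f\<close>: when all lengths are 1 the gain at integral points is
  half the difference of the two quadratic forms that are compared in the Voronoi cell.
\<close>

section \<open>The energy of an edge\<close>

text \<open>With \<open>k\<close> the floor of \<open>t / l\<close>, this is the chord of the
  parabola \<open>t^2 / (2 * l)\<close> over the interval from \<open>k * l\<close> to
  \<open>(k + 1) * l\<close>.\<close>

definition edge_energy :: "real \<Rightarrow> real \<Rightarrow> real" where
  "edge_energy l t = (of_int \<lfloor>t / l\<rfloor> + 1 / 2) * t - l * of_int \<lfloor>t / l\<rfloor> * (of_int \<lfloor>t / l\<rfloor> + 1) / 2"

text \<open>At the right end the floor has already jumped to \<open>k + 1\<close>, but neighbouring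
  chords agree at their common node, so the formula extends to the closed interval.\<close>

lemma edge_energy_on_interval:
  assumes "l > 0" "of_int k * l \<le> t" "t \<le> (of_int k + 1) * l"
  shows "edge_energy l t = (of_int k + 1 / 2) * t - l * of_int k * (of_int k + 1) / 2"
proof (cases "t = (of_int k + 1) * l")
  case True
  then have "t / l = of_int (k + 1)"
    using assms by (simp add: field_simps)
  then have "\<lfloor>t / l\<rfloor> = k + 1"
    by (metis floor_of_int)
  then show ?thesis
    unfolding edge_energy_def by (simp add: True field_simps)
next
  case False
  then have "\<lfloor>t / l\<rfloor> = k"
    using assms by (simp add: floor_eq_iff field_simps)
  then show ?thesis
    by (simp add: edge_energy_def)
qed

text \<open>With \<open>m\<close> the floor of \<open>t / l\<close>, the lines of index
  \<open>m\<close> and \<open>k\<close> differ at \<open>t\<close> by a product whose factors have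
  the same sign. So the energy is the maximum of its chord lines, which is its convexity.\<close>

lemma edge_energy_ge_line:
  assumes "l > 0"
  shows "(of_int k + 1 / 2) * t - l * of_int k * (of_int k + 1) / 2 \<le> edge_energy l t"
proof -
  define m where "m = \<lfloor>t / l\<rfloor>"
  have m: "of_int m * l \<le> t" "t \<le> (of_int m + 1) * l"
    using assms floor_divide_lower[of l t] floor_divide_upper[of l t] by (auto simp: m_def)
  have "0 \<le> (of_int m - of_int k) * (t - l * (of_int m + of_int k + 1) / 2)"
  proof (cases m k rule: linorder_cases)
    case less
    then have "l * (2 * (of_int m + 1)) \<le> l * (of_int m + of_int k + 1)"
      using assms by (intro mult_left_mono) auto
    then have "t - l * (of_int m + of_int k + 1) / 2 \<le> 0"
      using m by (simp add: algebra_simps)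
    with less show ?thesis
      by (intro mult_nonpos_nonpos) auto
  next
    case greater
    then have "l * (of_int m + of_int k + 1) \<le> l * (2 * of_int m)"
      using assms by (intro mult_left_mono) auto
    then have "0 \<le> t - l * (of_int m + of_int k + 1) / 2"
      using m by (simp add: algebra_simps)
    with greater show ?thesis
      by (intro mult_nonneg_nonneg) auto
  qed simp
  also have "\<dots> = edge_energy l t - ((of_int k + 1 / 2) * t - l * of_int k * (of_int k + 1) / 2)"
    unfolding edge_energy_def m_def[symmetric] by (simp add: field_simps)
  finally show ?thesis
    by simp
qed

text \<open>A chord of a parabola lies above it; the difference factors through the distances of
  \<open>t\<close> to the two nodes. This supplies the quadratic growth used in
  \<open>finite_nonneg_gains\<close>.\<close>

lemma edge_energy_ge_square:
  assumes "l > 0"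
  shows "t\<^sup>2 / (2 * l) \<le> edge_energy l t"
proof -
  define m where "m = \<lfloor>t / l\<rfloor>"
  have m: "of_int m * l \<le> t" "t \<le> (of_int m + 1) * l"
    using assms floor_divide_lower[of l t] floor_divide_upper[of l t] by (auto simp: m_def)
  have "0 \<le> (t - of_int m * l) * ((of_int m + 1) * l - t) / (2 * l)"
    using m assms by (intro divide_nonneg_pos mult_nonneg_nonneg) auto
  also have "\<dots> = edge_energy l t - t\<^sup>2 / (2 * l)"
    using assms unfolding edge_energy_def m_def[symmetric]
    by (simp add: field_simps power2_eq_square)
  finally show ?thesis
    by simp
qed

lemma edge_energy_at_multiple:
  assumes "l > 0"
  shows "edge_energy l (of_int k * l) = l * (of_int k)\<^sup>2 / 2"
  using edge_energy_on_interval[of l k "of_int k * l"] assms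
  by (simp add: field_simps power2_eq_square)

lemma edge_energy_subgradient_interval:
  assumes "l > 0" "of_int k * l \<le> s" "s \<le> (of_int k + 1) * l"
  shows "edge_energy l s + (of_int k + 1 / 2) * (t - s) \<le> edge_energy l t"
  using edge_energy_ge_line[OF assms(1), of k t]
  unfolding edge_energy_on_interval[OF assms] by (simp add: field_simps)

text \<open>At a node the chords of slope \<open>k - 1 / 2\<close> and \<open>k + 1 / 2\<close>
  meet, and every slope between them is a subgradient. This explains the half-width 1/2 of
  \<open>cube\<close> on divisible arcs.\<close>

lemma edge_energy_subgradient_multiple:
  assumes "l > 0" "\<bar>x - of_int k\<bar> \<le> 1 / 2"
  shows "edge_energy l (of_int k * l) + x * (t - of_int k * l) \<le> edge_energy l t"
proof (cases "t \<ge> of_int k * l")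
  case True
  then have "x * (t - of_int k * l) \<le> (of_int k + 1 / 2) * (t - of_int k * l)"
    using assms by (intro mult_right_mono) (auto simp: abs_if split: if_splits)
  then show ?thesis
    using edge_energy_subgradient_interval[of l k "of_int k * l" t] assms
    by (simp add: algebra_simps)
next
  case False
  then have "x * (t - of_int k * l) \<le> (of_int (k - 1) + 1 / 2) * (t - of_int k * l)"
    using assms by (intro mult_right_mono_neg) (auto simp: abs_if split: if_splits)
  then show ?thesis
    using edge_energy_subgradient_interval[of l "k - 1" "of_int k * l" t] assms
    by (simp add: algebra_simps)
qed

lemma edge_energy_linear:
  assumes "l > 0" "of_int k * l \<le> s" "s \<le> (of_int k + 1) * l"
    "of_int k * l \<le> t" "t \<le> (of_int k + 1) * l"
  shows "edge_energy l t = edge_energy l s + (of_int k + 1 / 2) * (t - s)"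
  using assms by (simp add: edge_energy_on_interval[of l k] field_simps)

section \<open>Zonotopes of graphs\<close>

lemma polytope_minkowski_sum:
  fixes S T :: "'a::euclidean_space set"
  assumes "polytope S" "polytope T"
  shows "polytope {x + y | x y. x \<in> S \<and> y \<in> T}"
proof -
  have "{x + y | x y. x \<in> S \<and> y \<in> T} = (\<lambda>p. fst p + snd p) ` (S \<times> T)"
    by force
  moreover have "linear (\<lambda>p :: 'a \<times> 'a. fst p + snd p)"
    by (intro linear_compose_add linear_fst linear_snd)
  ultimately show ?thesis
    using assms by (simp add: polytope_linear_image polytope_Times)
qed

lemma polytope_minkowski_sum_segments:
  fixes b :: "'i \<Rightarrow> 'a::euclidean_space"
  assumes "finite I"
  shows "polytope {\<Sum>i\<in>I. c i *\<^sub>R b i | c. \<forall>i\<in>I. \<bar>c i\<bar> \<le> 1 / 2}"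
  using assms
proof (induction I)
  case empty
  then show ?case
    by (simp add: polytope_sing)
next
  case (insert i I)
  let ?Z = "\<lambda>I. {\<Sum>i\<in>I. c i *\<^sub>R b i | c. \<forall>i\<in>I. \<bar>c i\<bar> \<le> 1 / 2}"
  let ?S = "closed_segment (- (1 / 2) *\<^sub>R b i) ((1 / 2) *\<^sub>R b i)"
  have seg: "x \<in> ?S \<longleftrightarrow> (\<exists>u. \<bar>u\<bar> \<le> 1 / 2 \<and> x = u *\<^sub>R b i)" for x
  proof
    assume "x \<in> ?S"
    then obtain u where u: "0 \<le> u" "u \<le> 1"
      "x = (1 - u) *\<^sub>R (- (1 / 2) *\<^sub>R b i) + u *\<^sub>R ((1 / 2) *\<^sub>R b i)"
      unfolding closed_segment_def by blast
    have "x = (u - 1 / 2) *\<^sub>R b i"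
      unfolding u(3) scaleR_scaleR scaleR_left_distrib[symmetric]
      by (rule arg_cong[where f = "\<lambda>t. t *\<^sub>R b i"]) (simp add: field_simps)
    with u(1,2) show "\<exists>u. \<bar>u\<bar> \<le> 1 / 2 \<and> x = u *\<^sub>R b i"
      by (intro exI[of _ "u - 1 / 2"]) (auto simp: abs_if)
  next
    assume "\<exists>u. \<bar>u\<bar> \<le> 1 / 2 \<and> x = u *\<^sub>R b i"
    then obtain u where u: "\<bar>u\<bar> \<le> 1 / 2" "x = u *\<^sub>R b i"
      by blast
    have "x = (1 - (u + 1 / 2)) *\<^sub>R (- (1 / 2) *\<^sub>R b i) + (u + 1 / 2) *\<^sub>R ((1 / 2) *\<^sub>R b i)"
      unfolding u(2) scaleR_scaleR scaleR_left_distrib[symmetric]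
      by (rule arg_cong[where f = "\<lambda>t. t *\<^sub>R b i"]) (simp add: field_simps)
    with u(1) show "x \<in> ?S"
      unfolding closed_segment_def by (intro CollectI exI[of _ "u + 1 / 2"]) auto
  qed
  have eq: "?Z (insert i I) = {x + y | x y. x \<in> ?S \<and> y \<in> ?Z I}"
  proof (intro set_eqI iffI)
    fix z assume "z \<in> ?Z (insert i I)"
    then obtain c where c: "z = (\<Sum>j\<in>insert i I. c j *\<^sub>R b j)" "\<forall>j\<in>insert i I. \<bar>c j\<bar> \<le> 1 / 2"
      by blast
    then have "z = c i *\<^sub>R b i + (\<Sum>j\<in>I. c j *\<^sub>R b j)" "c i *\<^sub>R b i \<in> ?S"
      using insert.hyps seg by auto
    with c(2) show "z \<in> {x + y | x y. x \<in> ?S \<and> y \<in> ?Z I}"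
      by blast
  next
    fix z assume "z \<in> {x + y | x y. x \<in> ?S \<and> y \<in> ?Z I}"
    then obtain x c where z: "z = x + (\<Sum>j\<in>I. c j *\<^sub>R b j)" "x \<in> ?S" "\<forall>j\<in>I. \<bar>c j\<bar> \<le> 1 / 2"
      by blast
    then obtain u where u: "\<bar>u\<bar> \<le> 1 / 2" "x = u *\<^sub>R b i"
      using seg by blast
    have "(\<Sum>j\<in>I. (c(i := u)) j *\<^sub>R b j) = (\<Sum>j\<in>I. c j *\<^sub>R b j)"
      using insert.hyps by (intro sum.cong) auto
    then have "z = (\<Sum>j\<in>insert i I. (c(i := u)) j *\<^sub>R b j)"
      using z u insert.hyps by simp
    moreover have "\<forall>j\<in>insert i I. \<bar>(c(i := u)) j\<bar> \<le> 1 / 2"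
      using z u by auto
    ultimately show "z \<in> ?Z (insert i I)"
      by blast
  qed
  have "polytope ?S"
    by (metis polytope_convex_hull segment_convex_hull finite.emptyI finite.insertI)
  from polytope_minkowski_sum[OF this insert.IH] show ?case
    by (simp only: eq)
qed

lemma subspace_H0: "subspace H0"
  by (auto simp: subspace_def H0_def sum.distrib sum_distrib_left[symmetric])

lemma H0_inner_const: "h \<in> H0 \<Longrightarrow> (\<chi> v. c) \<bullet> h = 0"
  by (simp add: H0_def inner_vec_def sum_distrib_left[symmetric])

text \<open>These axioms pass to \<open>divisible_subgraph\<close>, so the results below apply to
  \<open>G\<close> and to its subgraphs alike.\<close>

locale sym_graph =
  fixes G :: "('v::finite, 'e) pre_digraph" and arev :: "'e \<Rightarrow> 'e"
  assumes finite_arcs: "finite (arcs G)"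
    and verts_UNIV: "verts G = UNIV"
    and arev_arcs: "e \<in> arcs G \<Longrightarrow> arev e \<in> arcs G"
    and arev_arev: "e \<in> arcs G \<Longrightarrow> arev (arev e) = e"
    and tail_arev: "e \<in> arcs G \<Longrightarrow> tail G (arev e) = head G e"
begin

section \<open>Cuts, summation by parts and the Laplacian\<close>

lemma head_arev: "e \<in> arcs G \<Longrightarrow> head G (arev e) = tail G e"
  by (metis arev_arcs arev_arev tail_arev)

lemma sum_arcs_arev: "(\<Sum>e\<in>arcs G. F (arev e)) = (\<Sum>e\<in>arcs G. F e)"
  by (rule sum.reindex_bij_witness[of _ arev arev]) (auto simp: arev_arcs arev_arev)

text \<open>A path leaving \<open>A\<close> crosses its boundary, and \<open>arev\<close> turns the
  crossing arc into one that enters \<open>A\<close>. Conversely, no arc enters the set of vertices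
  reachable from \<open>u\<close> from outside, so this set is everything.\<close>

lemma connected_iff_cut:
  "Digraph_Component.connected G \<longleftrightarrow>
     (\<forall>A. A \<noteq> {} \<and> A \<noteq> UNIV \<longrightarrow> (\<exists>e\<in>arcs G. head G e \<in> A \<and> tail G e \<notin> A))"
proof
  assume con: "Digraph_Component.connected G"
  show "\<forall>A. A \<noteq> {} \<and> A \<noteq> UNIV \<longrightarrow> (\<exists>e\<in>arcs G. head G e \<in> A \<and> tail G e \<notin> A)"
  proof (intro allI impI)
    fix A :: "'v set" assume "A \<noteq> {} \<and> A \<noteq> UNIV"
    then obtain u v where uv: "u \<in> A" "v \<notin> A"
      by auto
    have "(u, v) \<in> rtrancl_on UNIV ((arcs_ends G)\<^sup>s)"
      using con by (simp add: connected_conv verts_UNIV)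
    then have "v \<in> A \<or> (\<exists>e\<in>arcs G. head G e \<in> A \<and> tail G e \<notin> A)"
    proof (induction rule: rtrancl_on_induct)
      case (step y z)
      from step.hyps(2) obtain e where e: "e \<in> arcs G"
        "(y, z) = (tail G e, head G e) \<or> (z, y) = (tail G e, head G e)"
        by (auto simp: symcl_def arcs_ends_def arc_to_ends_def)
      then have "\<exists>e'\<in>arcs G. head G e' = y \<and> tail G e' = z"
        using arev_arcs[of e] head_arev[of e] tail_arev[of e] by auto
      with step.IH show ?case
        by auto
    qed (use uv in auto)
    with uv show "\<exists>e\<in>arcs G. head G e \<in> A \<and> tail G e \<notin> A"
      by auto
  qed
next
  assume cut: "\<forall>A. A \<noteq> {} \<and> A \<noteq> UNIV \<longrightarrow> (\<exists>e\<in>arcs G. head G e \<in> A \<and> tail G e \<notin> A)"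
  have "(u, v) \<in> rtrancl_on UNIV ((arcs_ends G)\<^sup>s)" for u v
  proof -
    let ?R = "{w. (u, w) \<in> rtrancl_on UNIV ((arcs_ends G)\<^sup>s)}"
    have "head G e \<in> ?R \<Longrightarrow> tail G e \<in> ?R" if "e \<in> arcs G" for e
      using that
      by (auto intro!: rtrancl_on_into_rtrancl_on[of u "head G e"]
          simp: symcl_def arcs_ends_def arc_to_ends_def)
    moreover have "u \<in> ?R"
      by simp
    ultimately have "?R = UNIV"
      using cut[rule_format, of ?R] by blast
    then show ?thesis
      by blast
  qed
  then show "Digraph_Component.connected G"
    by (simp add: connected_conv verts_UNIV)
qed

lemma connected_invariant_set:
  assumes "Digraph_Component.connected G"
    and "P u" and "\<And>e. e \<in> arcs G \<Longrightarrow> P (head G e) \<Longrightarrow> P (tail G e)"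
  shows "P v"
proof -
  have "{v. P v} = UNIV"
    using assms connected_iff_cut[THEN iffD1, rule_format, of "{v. P v}"] by blast
  then show ?thesis
    by blast
qed

abbreviation grad :: "real^'v \<Rightarrow> 'e \<Rightarrow> real" where
  "grad g e \<equiv> g $ head G e - g $ tail G e"

text \<open>A function without differences is constant on a connected graph, and the sum condition
  kills the constant. It serves to show that orthogonal complements in \<open>H0\<close>
  vanish.\<close>

lemma grad_zero_imp_zero:
  assumes "Digraph_Component.connected G" "\<And>e. e \<in> arcs G \<Longrightarrow> grad g e = 0" "g \<in> H0"
  shows "g = 0"
proof -
  \<comment> \<open>An arbitrary base vertex.\<close>
  obtain v0 :: 'v where True
    by simp
  have c: "g $ v = g $ v0" for v
    using assms(1) by (rule connected_invariant_set) (use assms(2) in auto)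
  have "(\<Sum>v\<in>UNIV. g $ v) = of_nat CARD('v) * g $ v0"
    by (subst c) simp
  then have "g $ v0 = 0"
    using assms(3) by (simp add: H0_def)
  then show ?thesis
    using c by (simp add: vec_eq_iff)
qed

text \<open>Summation by parts. Grouping by heads gives one half of the difference, reindexing by
  \<open>arev\<close> the other; the division by 2 reflects that each edge occurs in both
  orientations.\<close>

lemma inner_coboundary_adj:
  assumes "x \<in> cochains1 G arev"
  shows "g \<bullet> coboundary_adj G x = (\<Sum>e\<in>arcs G. x e * grad g e) / 2"
proof -
  have "g \<bullet> coboundary_adj G x = (\<Sum>v\<in>UNIV. \<Sum>e | e \<in> arcs G \<and> head G e = v. g $ head G e * x e)"
    by (auto simp: coboundary_adj_def inner_vec_def in_arcs_def sum_distrib_left intro!: sum.cong)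
  also have "\<dots> = (\<Sum>e\<in>arcs G. g $ head G e * x e)"
    using sum.group[OF finite_arcs, of UNIV "head G" "\<lambda>e. g $ head G e * x e"] by simp
  finally have 1: "g \<bullet> coboundary_adj G x = (\<Sum>e\<in>arcs G. g $ head G e * x e)" .
  have "(\<Sum>e\<in>arcs G. g $ head G e * x e) = (\<Sum>e\<in>arcs G. g $ head G (arev e) * x (arev e))"
    by (rule sum_arcs_arev[symmetric])
  also have "\<dots> = - (\<Sum>e\<in>arcs G. g $ tail G e * x e)"
    using assms by (simp add: head_arev cochains1_def sum_negf)
  finally have 2: "(\<Sum>e\<in>arcs G. g $ head G e * x e) = - (\<Sum>e\<in>arcs G. g $ tail G e * x e)" .
  have "(\<Sum>e\<in>arcs G. x e * grad g e) =
      (\<Sum>e\<in>arcs G. g $ head G e * x e) - (\<Sum>e\<in>arcs G. g $ tail G e * x e)"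
    by (simp add: sum_subtractf algebra_simps)
  with 1 2 show ?thesis
    by simp
qed

lemma coboundary_adj_in_H0:
  assumes "x \<in> cochains1 G arev"
  shows "coboundary_adj G x \<in> H0"
  using inner_coboundary_adj[OF assms, of "\<chi> v. 1"] by (simp add: H0_def inner_vec_def)

lemma coboundary_cochains1: "coboundary G f \<in> cochains1 G arev"
  by (auto simp: cochains1_def coboundary_def arev_arcs tail_arev head_arev)

lemma inner_laplacian: "g \<bullet> laplacian G f = (\<Sum>e\<in>arcs G. grad f e * grad g e) / 2"
  unfolding laplacian_def
  by (subst inner_coboundary_adj[OF coboundary_cochains1]) (auto simp: coboundary_def intro!: sum.cong)

lemma inner_laplacian_commute: "g \<bullet> laplacian G f = f \<bullet> laplacian G g"
  by (simp add: inner_laplacian mult.commute)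

lemma laplacian_in_H0: "laplacian G f \<in> H0"
  unfolding laplacian_def by (intro coboundary_adj_in_H0 coboundary_cochains1)

lemma linear_laplacian: "linear (laplacian G)"
proof (intro linearI; subst vector_eq_ldot[symmetric])
  show "\<forall>g. g \<bullet> laplacian G (a + b) = g \<bullet> (laplacian G a + laplacian G b)" for a b
    by (simp add: inner_add_right inner_laplacian add_divide_distrib[symmetric]
        sum.distrib[symmetric] algebra_simps)
  show "\<forall>g. g \<bullet> laplacian G (r *\<^sub>R a) = g \<bullet> (r *\<^sub>R laplacian G a)" for r a
    by (simp add: inner_laplacian sum_distrib_left right_diff_distrib mult_ac)
qed

text \<open>Split \<open>h\<close> into a part in the range and a part \<open>z\<close> orthogonal
  to it. Being orthogonal to its own Laplacian, \<open>z\<close> has zero Dirichlet energy, hence is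
  constant, and it lies in \<open>H0\<close>.\<close>

lemma laplacian_surj_H0:
  assumes "Digraph_Component.connected G" "h \<in> H0"
  obtains u where "laplacian G u = h"
proof -
  have sub: "subspace (range (laplacian G))"
    using linear_subspace_image[OF linear_laplacian subspace_UNIV] .
  obtain y z where yz: "y \<in> span (range (laplacian G))"
    "\<And>w. w \<in> span (range (laplacian G)) \<Longrightarrow> orthogonal z w" "h = y + z"
    using orthogonal_subspace_decomp_exists by blast
  then obtain u where u: "y = laplacian G u"
    using sub by (auto simp: span_eq_iff[THEN iffD2])
  have "z = h - y"
    using yz by simp
  then have z: "z \<in> H0"
    using assms(2) u laplacian_in_H0 subspace_diff[OF subspace_H0] by blast
  have "z \<bullet> laplacian G z = 0"
    using yz(2) by (simp add: orthogonal_def span_base)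
  then have "(\<Sum>e\<in>arcs G. (grad z e)\<^sup>2) = 0"
    by (simp add: inner_laplacian power2_eq_square)
  then have "\<forall>e\<in>arcs G. grad z e = 0"
    by (subst (asm) sum_nonneg_eq_0_iff) (auto simp: finite_arcs)
  then have "z = 0"
    using grad_zero_imp_zero[OF assms(1) _ z] by blast
  then show ?thesis
    using that u yz by simp
qed

text \<open>Independence of the preimage follows from symmetry: if \<open>f\<close> and
  \<open>u\<close> have the same Laplacian, each may be moved across the inner product in
  turn.\<close>

lemma laplacian_form_laplacian: "laplacian_form G (laplacian G u) = u \<bullet> laplacian G u"
  unfolding laplacian_form_def
proof (rule the_equality)
  fix r assume "\<exists>f. laplacian G f = laplacian G u \<and> r = f \<bullet> laplacian G f"
  then obtain f where "laplacian G f = laplacian G u" "r = f \<bullet> laplacian G f"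
    by blast
  then show "r = u \<bullet> laplacian G u"
    by (metis inner_laplacian_commute)
qed blast

end

text \<open>The coefficients are free on every arc instead of antisymmetric, which makes this a
  plain Minkowski sum of segments. Each edge contributes twice, hence the factor 1/2 in the
  generators.\<close>

definition zonotope :: "('v::finite, 'e) pre_digraph \<Rightarrow> (real^'v) set" where
  "zonotope G = {\<Sum>e\<in>arcs G. c e *\<^sub>R ((1 / 2) *\<^sub>R (axis (head G e) 1 - axis (tail G e) 1)) | c.
     \<forall>e\<in>arcs G. \<bar>c e\<bar> \<le> 1 / 2}"

context sym_graph
begin

section \<open>Shape and dimension of the graphical zonotope\<close>

lemma polytope_zonotope: "polytope (zonotope G)"
  unfolding zonotope_def by (rule polytope_minkowski_sum_segments[OF finite_arcs])

lemma coboundary_adj_eq_sum: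
  assumes "x \<in> cochains1 G arev"
  shows "coboundary_adj G x = (\<Sum>e\<in>arcs G. x e *\<^sub>R ((1 / 2) *\<^sub>R (axis (head G e) 1 - axis (tail G e) 1)))"
  by (subst vector_eq_ldot[symmetric])
    (auto simp: inner_coboundary_adj[OF assms] inner_sum_right inner_diff_right inner_axis
      sum_divide_distrib intro!: sum.cong)

lemma zonotope_eq_image:
  "zonotope G = coboundary_adj G ` {x \<in> cochains1 G arev. \<forall>e\<in>arcs G. \<bar>x e\<bar> \<le> 1 / 2}"
proof (intro equalityI subsetI)
  fix z assume "z \<in> coboundary_adj G ` {x \<in> cochains1 G arev. \<forall>e\<in>arcs G. \<bar>x e\<bar> \<le> 1 / 2}"
  then show "z \<in> zonotope G"
    unfolding zonotope_def using coboundary_adj_eq_sum by blast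
next
  fix z assume "z \<in> zonotope G"
  let ?b = "\<lambda>e. (1 / 2) *\<^sub>R (axis (head G e) 1 - axis (tail G e) 1 :: real^'v)"
  obtain c where c: "z = (\<Sum>e\<in>arcs G. c e *\<^sub>R ?b e)" "\<forall>e\<in>arcs G. \<bar>c e\<bar> \<le> 1 / 2"
    using \<open>z \<in> zonotope G\<close> unfolding zonotope_def by blast
  \<comment> \<open>Antisymmetrising \<open>c\<close> keeps the bound and the sum, because the
    generators of \<open>e\<close> and \<open>arev e\<close> are opposite.\<close>
  define x where "x e = (if e \<in> arcs G then (c e - c (arev e)) / 2 else 0)" for e
  have x: "x \<in> cochains1 G arev"
    by (auto simp: cochains1_def x_def arev_arcs arev_arev field_simps)
  have "\<bar>x e\<bar> \<le> 1 / 2" if "e \<in> arcs G" for e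
  proof -
    have "\<bar>c e\<bar> \<le> 1 / 2" "\<bar>c (arev e)\<bar> \<le> 1 / 2"
      using c(2) that arev_arcs by blast+
    then show ?thesis
      using that by (simp add: x_def abs_if split: if_splits)
  qed
  moreover have "(\<Sum>e\<in>arcs G. c (arev e) *\<^sub>R ?b e) = - z"
  proof -
    have "(\<Sum>e\<in>arcs G. c (arev e) *\<^sub>R ?b e) = (\<Sum>e\<in>arcs G. c (arev (arev e)) *\<^sub>R ?b (arev e))"
      by (rule sum_arcs_arev[symmetric])
    also have "\<dots> = (\<Sum>e\<in>arcs G. - (c e *\<^sub>R ?b e))"
      by (intro sum.cong) (auto simp: arev_arev head_arev tail_arev algebra_simps)
    finally show ?thesis
      by (simp add: c(1) sum_negf)
  qed
  then have "coboundary_adj G x = z"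
  proof -
    have "coboundary_adj G x = (\<Sum>e\<in>arcs G. (1 / 2) *\<^sub>R (c e *\<^sub>R ?b e) - (1 / 2) *\<^sub>R (c (arev e) *\<^sub>R ?b e))"
      unfolding coboundary_adj_eq_sum[OF x]
      by (intro sum.cong) (auto simp: x_def scaleR_left_diff_distrib diff_divide_distrib)
    also have "\<dots> = (1 / 2) *\<^sub>R z - (1 / 2) *\<^sub>R (\<Sum>e\<in>arcs G. c (arev e) *\<^sub>R ?b e)"
      by (simp only: sum_subtractf scaleR_sum_right[symmetric] c(1)[symmetric])
    also have "\<dots> = z"
      unfolding \<open>(\<Sum>e\<in>arcs G. c (arev e) *\<^sub>R ?b e) = - z\<close>
      using scaleR_half_double[of z] by (simp add: scaleR_right_distrib)
    finally show ?thesis .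
  qed
  ultimately show "z \<in> coboundary_adj G ` {x \<in> cochains1 G arev. \<forall>e\<in>arcs G. \<bar>x e\<bar> \<le> 1 / 2}"
    using x by blast
qed

lemma zero_in_zonotope: "0 \<in> zonotope G"
  unfolding zonotope_def by (rule CollectI, rule exI[of _ "\<lambda>_. 0"]) simp

lemma zonotope_subset_H0: "zonotope G \<subseteq> H0"
  unfolding zonotope_eq_image using coboundary_adj_in_H0 by blast

lemma half_generator_in_zonotope:
  assumes "e \<in> arcs G"
  shows "(1 / 4) *\<^sub>R (axis (head G e) 1 - axis (tail G e) 1) \<in> zonotope G"
proof -
  let ?b = "\<lambda>e. (1 / 2) *\<^sub>R (axis (head G e) 1 - axis (tail G e) 1 :: real^'v)"
  have "(\<Sum>e'\<in>arcs G. (if e' = e then 1 / 2 else 0) *\<^sub>R ?b e') =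
      (\<Sum>e'\<in>arcs G. if e' = e then (1 / 2) *\<^sub>R ?b e else 0)"
    by (intro sum.cong) auto
  also have "\<dots> = (1 / 4) *\<^sub>R (axis (head G e) 1 - axis (tail G e) 1)"
    using assms finite_arcs by (simp add: sum.delta)
  finally show ?thesis
    unfolding zonotope_def by (intro CollectI exI[of _ "\<lambda>e'. if e' = e then 1 / 2 else 0"]) auto
qed

text \<open>A vector of \<open>H0\<close> orthogonal to the zonotope is orthogonal to every
  generator, so it has no differences along arcs and vanishes. Hence the zonotope spans
  \<open>H0\<close>, and it contains 0.\<close>

lemma aff_dim_zonotope:
  assumes "Digraph_Component.connected G"
  shows "aff_dim (zonotope G) = aff_dim (H0 :: (real^'v) set)"
proof -
  have "h \<in> span (zonotope G)" if h: "h \<in> H0" for h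
  proof -
    obtain y z where yz: "y \<in> span (zonotope G)"
      "\<And>w. w \<in> span (zonotope G) \<Longrightarrow> orthogonal z w" "h = y + z"
      using orthogonal_subspace_decomp_exists by blast
    have "y \<in> H0"
      using yz(1) zonotope_subset_H0 subspace_H0 span_minimal by blast
    moreover have "z = h - y"
      using yz by simp
    ultimately have z: "z \<in> H0"
      using h subspace_diff[OF subspace_H0] by blast
    have "grad z e = 0" if "e \<in> arcs G" for e
      using yz(2)[OF span_base, OF half_generator_in_zonotope[OF that]]
      by (simp add: orthogonal_def inner_diff_right inner_axis)
    then have "z = 0"
      using grad_zero_imp_zero[OF assms _ z] by blast
    then show ?thesis
      using yz by simp
  qed
  then have "span (zonotope G) = H0"
    using zonotope_subset_H0 subspace_H0 span_minimal by blast
  then have "dim (zonotope G) = dim (H0 :: (real^'v) set)"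
    by (metis dim_span)
  moreover have "0 \<in> affine hull (zonotope G)" "0 \<in> affine hull (H0 :: (real^'v) set)"
    using zero_in_zonotope subspace_0[OF subspace_H0] by (auto intro: hull_inc)
  ultimately show ?thesis
    by (simp add: aff_dim_zero)
qed

end

section \<open>Cells as sets of maximisers\<close>

locale metric_graph = sym_graph +
  fixes l :: "'b \<Rightarrow> int"
  assumes l_pos: "e \<in> arcs G \<Longrightarrow> 0 < l e"
    and l_arev: "e \<in> arcs G \<Longrightarrow> l (arev e) = l e"
begin

abbreviation rvec :: "('a \<Rightarrow> int) \<Rightarrow> real^'a" where
  "rvec f \<equiv> (\<chi> v. real_of_int (f v))"

section \<open>Cells as translated zonotopes\<close>

lemma sym_graph_divisible: "sym_graph (divisible_subgraph G l f) arev"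
  by unfold_locales
    (auto simp: divisible_subgraph_def finite_arcs verts_UNIV arev_arcs arev_arev tail_arev
      head_arev l_arev dvd_diff_commute)

text \<open>If the difference is not divisible, negation sends the floor \<open>q\<close> to
  \<open>- q - 1\<close>; the summand 1/2 in \<open>slope\<close> restores antisymmetry.\<close>

lemma slope_cochains1: "slope G l f \<in> cochains1 G arev"
proof -
  have "slope G l f (arev e) = - slope G l f e" if e: "e \<in> arcs G" for e
  proof -
    define a where "a = f (head G e) - f (tail G e)"
    have "slope G l f e = (if l e dvd a then of_int a / of_int (l e) else of_int (a div l e) + 1 / 2)"
      using e by (simp add: slope_def a_def floor_divide_of_int_eq del: of_int_diff)
    moreover have "slope G l f (arev e) =
        (if l e dvd - a then of_int (- a) / of_int (l e) else of_int ((- a) div l e) + 1 / 2)"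
      using e by (simp add: slope_def a_def floor_divide_of_int_eq arev_arcs tail_arev head_arev
          l_arev del: of_int_diff)
    moreover have "(- a) div l e = - (a div l e) - 1" if "\<not> l e dvd a"
      using that l_pos[OF e] by (simp add: zdiv_zminus1_eq_if dvd_eq_mod_eq_0)
    ultimately show ?thesis
      by simp
  qed
  then show ?thesis
    by (auto simp: cochains1_def slope_def)
qed

text \<open>The perturbations allowed in \<open>cube\<close> are exactly the cochains of
  \<open>divisible_subgraph\<close> bounded by 1/2, and both adjoints agree on them. The polytope
  properties and the dimension of \<open>VorH\<close> are read off from this.\<close>

lemma VorH_eq_translated_zonotope:
  "VorH G arev l f = (\<lambda>x. coboundary_adj G (slope G l f) + x) ` zonotope (divisible_subgraph G l f)"
proof -
  let ?H = "divisible_subgraph G l f"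
  interpret H: sym_graph ?H arev
    by (rule sym_graph_divisible)
  let ?E = "{x \<in> cochains1 ?H arev. \<forall>e\<in>arcs ?H. \<bar>x e\<bar> \<le> 1 / 2}"
  have sub: "arcs ?H \<subseteq> arcs G"
    by (auto simp: divisible_subgraph_def)
  have E: "x \<in> cochains1 G arev \<and> (\<forall>e\<in>arcs G. \<bar>x e\<bar> \<le> 1 / 2) \<and>
        (\<forall>e\<in>arcs G. e \<notin> arcs ?H \<longrightarrow> x e = 0) \<longleftrightarrow> x \<in> ?E" for x
  proof
    assume "x \<in> ?E"
    then have *: "\<And>e. e \<in> arcs ?H \<Longrightarrow> x (arev e) = - x e" "\<And>e. e \<notin> arcs ?H \<Longrightarrow> x e = 0"
      "\<And>e. e \<in> arcs ?H \<Longrightarrow> \<bar>x e\<bar> \<le> 1 / 2"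
      by (auto simp: cochains1_def)
    have "x (arev e) = - x e" if "e \<in> arcs G" for e
    proof (cases "e \<in> arcs ?H")
      case False
      then have "arev e \<notin> arcs ?H"
        using H.arev_arcs arev_arev that by metis
      then show ?thesis
        using False * by simp
    qed (use * in auto)
    moreover have "\<bar>x e\<bar> \<le> 1 / 2" for e
      using * by (cases "e \<in> arcs ?H") auto
    ultimately show "x \<in> cochains1 G arev \<and> (\<forall>e\<in>arcs G. \<bar>x e\<bar> \<le> 1 / 2) \<and>
        (\<forall>e\<in>arcs G. e \<notin> arcs ?H \<longrightarrow> x e = 0)"
      using * sub unfolding cochains1_def by blast
  qed (use sub in \<open>auto simp: cochains1_def\<close>)
  have adj: "coboundary_adj G (\<lambda>e. slope G l f e + x e) = coboundary_adj G (slope G l f) + coboundary_adj ?H x"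
    if "x \<in> ?E" for x
  proof -
    have "(\<Sum>e\<in>in_arcs G v. x e) = (\<Sum>e\<in>in_arcs ?H v. x e)" for v
      using that finite_arcs
      by (intro sum.mono_neutral_right)
        (auto simp: in_arcs_def cochains1_def divisible_subgraph_def)
    then show ?thesis
      by (simp add: coboundary_adj_def vec_eq_iff sum.distrib)
  qed
  have "VorH G arev l f = (\<lambda>x. coboundary_adj G (\<lambda>e. slope G l f e + x e)) ` ?E"
    unfolding VorH_def cube_def E by blast
  also have "\<dots> = (\<lambda>x. coboundary_adj G (slope G l f) + coboundary_adj ?H x) ` ?E"
    using adj by (intro image_cong) auto
  finally show ?thesis
    unfolding H.zonotope_eq_image image_image .
qed

lemma polytope_VorH: "polytope (VorH G arev l f)"
  unfolding VorH_eq_translated_zonotope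
  using sym_graph.polytope_zonotope[OF sym_graph_divisible] by (simp add: polytope_translation_eq)

lemma VorH_nonempty: "VorH G arev l f \<noteq> {}"
  unfolding VorH_eq_translated_zonotope
  using sym_graph.zero_in_zonotope[OF sym_graph_divisible] by blast

lemma aff_dim_VorH:
  assumes "Digraph_Component.connected (divisible_subgraph G l f)"
  shows "aff_dim (VorH G arev l f) = aff_dim (H0 :: (real^'a) set)"
  unfolding VorH_eq_translated_zonotope
  by (simp add: aff_dim_translation_eq sym_graph.aff_dim_zonotope[OF sym_graph_divisible assms])

lemma cube_cochains1: "x \<in> cube G arev l f \<Longrightarrow> x \<in> cochains1 G arev"
  using slope_cochains1[of f] by (auto simp: cube_def cochains1_def)

lemma VorH_subset_H0: "VorH G arev l f \<subseteq> H0"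
  unfolding VorH_def using cube_cochains1 coboundary_adj_in_H0 by blast

section \<open>The gain and its maximisers\<close>

definition energy :: "real^'a \<Rightarrow> real" where
  "energy g = (\<Sum>e\<in>arcs G. edge_energy (l e) (grad g e)) / 2"

definition gain :: "real^'a \<Rightarrow> real^'a \<Rightarrow> real" where
  "gain h g = g \<bullet> h - energy g"

text \<open>By integrality of \<open>f\<close>, a non-divisible difference keeps distance at least 1
  from the neighbouring multiples of \<open>l e\<close>. This margin lets
  \<open>edge_energy_directional\<close> take steps up to 1 within one chord.\<close>

lemma divisible_cases:
  assumes "e \<in> arcs G"
  obtains (div) k where "e \<in> arcs (divisible_subgraph G l f)" "slope G l f e = of_int k"
      "grad (rvec f) e = of_int k * of_int (l e)"
  | (nondiv) k where "e \<notin> arcs (divisible_subgraph G l f)" "slope G l f e = of_int k + 1 / 2"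
      "of_int k * of_int (l e) + 1 \<le> grad (rvec f) e"
      "grad (rvec f) e + 1 \<le> (of_int k + 1) * real_of_int (l e)"
proof (cases "l e dvd f (head G e) - f (tail G e)")
  case True
  then obtain k where k: "f (head G e) - f (tail G e) = l e * k"
    by blast
  show ?thesis
  proof (rule div[of k])
    show "grad (rvec f) e = of_int k * of_int (l e)"
      using arg_cong[OF k, of real_of_int] by simp
    show "slope G l f e = of_int k"
      using assms l_pos[OF assms] by (simp add: slope_def k)
  qed (use True assms in \<open>auto simp: divisible_subgraph_def\<close>)
next
  case False
  define a where "a = f (head G e) - f (tail G e)"
  define k where "k = a div l e"
  have "0 < a mod l e"
    using False l_pos[OF assms] by (metis a_def dvd_eq_mod_eq_0 order_le_less pos_mod_sign)
  moreover have "a mod l e < l e"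
    using l_pos[OF assms] by simp
  moreover have "a = k * l e + a mod l e"
    by (simp add: k_def)
  ultimately have "k * l e + 1 \<le> a" "a + 1 \<le> (k + 1) * l e"
    by (simp_all add: algebra_simps)
  then have "real_of_int (k * l e + 1) \<le> of_int a" "real_of_int (a + 1) \<le> of_int ((k + 1) * l e)"
    by (simp_all only: of_int_le_iff)
  then show ?thesis
    using False assms
    by (intro nondiv[of k])
      (auto simp: slope_def divisible_subgraph_def a_def k_def floor_divide_of_int_eq simp flip: of_int_diff)
qed

lemma cube_subgradient:
  assumes "x \<in> cube G arev l f" "e \<in> arcs G"
  shows "edge_energy (l e) (grad (rvec f) e) + x e * (t - grad (rvec f) e) \<le> edge_energy (l e) t"
  using assms(2)
proof (cases rule: divisible_cases[where f = f])
  case (div k)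
  have "\<bar>x e - of_int k\<bar> \<le> 1 / 2"
    using assms div(2) by (auto simp: cube_def)
  then show ?thesis
    unfolding div(3) using l_pos[OF assms(2)] by (intro edge_energy_subgradient_multiple) auto
next
  case (nondiv k)
  have "x e = of_int k + 1 / 2"
    using assms nondiv(1,2) by (auto simp: cube_def)
  then show ?thesis
    using edge_energy_subgradient_interval[of "l e" k "grad (rvec f) e" t] nondiv l_pos[OF assms(2)]
    by simp
qed

text \<open>A preimage of \<open>h\<close> in the cube consists of subgradients of the edge
  energies. Their inequalities add up, and summation by parts turns the linear terms into an inner
  product with \<open>h\<close>.\<close>

lemma gain_le_of_mem_VorH:
  assumes "h \<in> VorH G arev l f"
  shows "gain h g \<le> gain h (rvec f)"
proof -
  obtain x where x: "x \<in> cube G arev l f" "h = coboundary_adj G x"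
    using assms by (auto simp: VorH_def)
  have "(\<Sum>e\<in>arcs G. edge_energy (l e) (grad (rvec f) e) + x e * (grad g e - grad (rvec f) e))
      \<le> (\<Sum>e\<in>arcs G. edge_energy (l e) (grad g e))"
    by (intro sum_mono cube_subgradient x)
  moreover have "(g - rvec f) \<bullet> h = (\<Sum>e\<in>arcs G. x e * (grad g e - grad (rvec f) e)) / 2"
    unfolding x(2) inner_coboundary_adj[OF cube_cochains1[OF x(1)]]
    by (simp add: algebra_simps)
  ultimately show ?thesis
    by (simp add: gain_def energy_def inner_diff_left sum.distrib)
qed

text \<open>At a divisible difference the sign of \<open>s\<close> selects the right or the left
  chord; elsewhere a single chord is involved.\<close>

lemma edge_energy_directional:
  assumes "e \<in> arcs G" "\<bar>s\<bar> \<le> 1"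
  shows "edge_energy (l e) (grad (rvec f) e + s) = edge_energy (l e) (grad (rvec f) e) +
    (slope G l f e + (if e \<in> arcs (divisible_subgraph G l f) then sgn s / 2 else 0)) * s"
proof -
  have l: "1 \<le> real_of_int (l e)"
    using l_pos[OF assms(1)] by simp
  show ?thesis
    using assms(1)
  proof (cases rule: divisible_cases[where f = f])
    case (div k)
    show ?thesis
    proof (cases "s \<ge> 0")
      case True
      then have "edge_energy (l e) (grad (rvec f) e + s) = edge_energy (l e) (grad (rvec f) e) +
          (of_int k + 1 / 2) * s"
        using edge_energy_linear[of "l e" k "grad (rvec f) e" "grad (rvec f) e + s"] l assms(2)
        unfolding div(3) by (simp add: algebra_simps)
      then show ?thesis
        using True div by (simp add: sgn_if)
    next
      case False
      then have "edge_energy (l e) (grad (rvec f) e + s) = edge_energy (l e) (grad (rvec f) e) +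
          (of_int (k - 1) + 1 / 2) * s"
        using edge_energy_linear[of "l e" "k - 1" "grad (rvec f) e" "grad (rvec f) e + s"] l assms(2)
        unfolding div(3) by (simp add: algebra_simps)
      then show ?thesis
        using False div by (simp add: sgn_if)
    qed
  next
    case (nondiv k)
    then show ?thesis
      using edge_energy_linear[of "l e" k "grad (rvec f) e" "grad (rvec f) e + s"] l assms(2)
      by (simp add: abs_le_iff)
  qed
qed

text \<open>If a hyperplane separates \<open>h\<close> from the cell, its normal is a direction in
  which the gain strictly increases from \<open>f\<close>.\<close>

lemma mem_VorH_of_gain_max:
  assumes "\<And>g. gain h g \<le> gain h (rvec f)"
  shows "h \<in> VorH G arev l f"
proof (rule ccontr)
  assume "h \<notin> VorH G arev l f"
  then obtain a b where ab: "a \<bullet> h < b" "\<And>y. y \<in> VorH G arev l f \<Longrightarrow> b < a \<bullet> y"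
    using separating_hyperplane_closed_point[of "VorH G arev l f" h]
      polytope_imp_convex[OF polytope_VorH] polytope_imp_closed[OF polytope_VorH] by blast
  define g where "g = - a"
  \<comment> \<open>The point of the cube that is extreme in direction \<open>g\<close>: its entries
    are the one-sided slopes of the edge energies, so the energy grows at rate
    \<open>g \<bullet> y\<close> along \<open>g\<close>.\<close>
  define x where "x e = slope G l f e +
    (if e \<in> arcs (divisible_subgraph G l f) then sgn (grad g e) / 2 else 0)" for e
  interpret H: sym_graph "divisible_subgraph G l f" arev
    by (rule sym_graph_divisible)
  have sub: "arcs (divisible_subgraph G l f) \<subseteq> arcs G"
    by (auto simp: divisible_subgraph_def)
  have rev: "arev e \<in> arcs (divisible_subgraph G l f) \<longleftrightarrow> e \<in> arcs (divisible_subgraph G l f)"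
    if "e \<in> arcs G" for e
    using that H.arev_arcs arev_arev by metis
  have x: "x \<in> cube G arev l f"
    unfolding cube_def
  proof (intro CollectI exI conjI)
    show "x = (\<lambda>e. slope G l f e +
        (if e \<in> arcs (divisible_subgraph G l f) then sgn (grad g e) / 2 else 0))"
      by (simp add: x_def fun_eq_iff)
    show "(\<lambda>e. if e \<in> arcs (divisible_subgraph G l f) then sgn (grad g e) / 2 else 0)
        \<in> cochains1 G arev"
      using sub by (auto simp: cochains1_def rev head_arev tail_arev sgn_if)
  qed (auto simp: sgn_if)
  define y where "y = coboundary_adj G x"
  have "y \<in> VorH G arev l f"
    using x by (simp add: VorH_def y_def)
  then have less: "g \<bullet> y < g \<bullet> h"
    using ab(1) ab(2)[of y] by (simp add: g_def)
  \<comment> \<open>The step is short enough for \<open>edge_energy_directional\<close> on every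
    arc; the summand 1 keeps the denominator positive.\<close>
  define t where "t = 1 / (1 + (\<Sum>e\<in>arcs G. \<bar>grad g e\<bar>))"
  have S: "0 \<le> (\<Sum>e\<in>arcs G. \<bar>grad g e\<bar>)"
    by (intro sum_nonneg) auto
  have t: "0 < t"
    using S by (simp add: t_def add_pos_nonneg)
  have small: "\<bar>t * grad g e\<bar> \<le> 1" if "e \<in> arcs G" for e
  proof -
    have "\<bar>grad g e\<bar> \<le> (\<Sum>e\<in>arcs G. \<bar>grad g e\<bar>)"
      using finite_arcs that by (intro member_le_sum) auto
    then show ?thesis
      using S by (simp add: t_def abs_mult)
  qed
  have "edge_energy (l e) (grad (rvec f + t *\<^sub>R g) e) =
      edge_energy (l e) (grad (rvec f) e) + t * (x e * grad g e)" if "e \<in> arcs G" for e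
  proof -
    have "grad (rvec f + t *\<^sub>R g) e = grad (rvec f) e + t * grad g e"
      by (simp add: algebra_simps)
    moreover have "sgn (t * grad g e) = sgn (grad g e)"
      using t by (simp add: sgn_mult)
    ultimately show ?thesis
      using edge_energy_directional[OF that small[OF that], of f]
      by (simp only: x_def mult.left_commute)
  qed
  then have "energy (rvec f + t *\<^sub>R g) = energy (rvec f) + t * (g \<bullet> y)"
    unfolding energy_def y_def inner_coboundary_adj[OF cube_cochains1[OF x]]
    by (simp add: sum.distrib sum_distrib_left[symmetric] add_divide_distrib)
  then have "gain h (rvec f + t *\<^sub>R g) = gain h (rvec f) + t * (g \<bullet> h - g \<bullet> y)"
    by (simp add: gain_def inner_add_left algebra_simps)
  moreover have "0 < t * (g \<bullet> h - g \<bullet> y)"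
    using t less by simp
  ultimately show False
    using assms[of "rvec f + t *\<^sub>R g"] by linarith
qed

lemma mem_VorH_iff: "h \<in> VorH G arev l f \<longleftrightarrow> (\<forall>g. gain h g \<le> gain h (rvec f))"
  using gain_le_of_mem_VorH mem_VorH_of_gain_max by blast

text \<open>On the cell of \<open>f\<close> the gain of \<open>f'\<close> is at most that of
  \<open>f\<close>, with equality exactly on the cell of \<open>f'\<close>. Since gains are affine
  in \<open>h\<close>, equality defines a supporting hyperplane.\<close>

lemma VorH_Int_face: "VorH G arev l f \<inter> VorH G arev l f' face_of VorH G arev l f"
proof -
  let ?a = "rvec f - rvec f'" and ?b = "energy (rvec f) - energy (rvec f')"
  have "VorH G arev l f \<inter> VorH G arev l f' = VorH G arev l f \<inter> {h. ?a \<bullet> h = ?b}"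
  proof (intro set_eqI)
    fix h
    have "gain h (rvec f') = gain h (rvec f)" if "h \<in> VorH G arev l f" "h \<in> VorH G arev l f'"
      using gain_le_of_mem_VorH that by (simp add: order_antisym)
    moreover have "?a \<bullet> h = ?b \<longleftrightarrow> gain h (rvec f') = gain h (rvec f)"
      by (auto simp: gain_def inner_diff_left)
    ultimately show "h \<in> VorH G arev l f \<inter> VorH G arev l f' \<longleftrightarrow>
        h \<in> VorH G arev l f \<inter> {h. ?a \<bullet> h = ?b}"
      using mem_VorH_iff by auto
  qed
  moreover have "?b \<le> ?a \<bullet> h" if "h \<in> VorH G arev l f" for h
    using gain_le_of_mem_VorH[OF that, of "rvec f'"] by (simp add: gain_def inner_diff_left)
  ultimately show ?thesis
    using face_of_Int_supporting_hyperplane_ge[OF polytope_imp_convex[OF polytope_VorH]] by simp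
qed

end

section \<open>The covering\<close>

context metric_graph
begin

section \<open>Shifts along cuts and integral maximisers\<close>

abbreviation ind :: "'a set \<Rightarrow> real^'a" where
  "ind A \<equiv> (\<chi> v. if v \<in> A then 1 else 0)"

definition nonint_arcs :: "real^'a \<Rightarrow> 'b set" where
  "nonint_arcs F = {e \<in> arcs G. grad F e / of_int (l e) \<notin> \<int>}"

text \<open>The derivative of the gain at \<open>F\<close> in direction \<open>ind A\<close>,
  provided that all arcs across the cut have non-integral slope.\<close>

definition cut_rate :: "real^'a \<Rightarrow> real^'a \<Rightarrow> 'a set \<Rightarrow> real" where
  "cut_rate h F A = ind A \<bullet> h -
     (\<Sum>e\<in>arcs G. (of_int \<lfloor>grad F e / of_int (l e)\<rfloor> + 1 / 2) * grad (ind A) e) / 2"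

text \<open>The indicators of \<open>A\<close> and \<open>- A\<close> add up to a constant, which is
  orthogonal to \<open>h\<close> and has no differences. Thus one of the two sides can be raised
  without loss.\<close>

lemma cut_rate_Compl:
  assumes "h \<in> H0"
  shows "cut_rate h F (- A) = - cut_rate h F A"
proof -
  have "ind (- A) = (\<chi> v. 1) - ind A"
    by (simp add: vec_eq_iff)
  then have "ind (- A) \<bullet> h = - (ind A \<bullet> h)"
    using H0_inner_const[OF assms, of 1] by (simp only: inner_diff_left)
  moreover have "grad (ind (- A)) e = - grad (ind A) e" for e
    by simp
  ultimately show ?thesis
    unfolding cut_rate_def by (simp only: mult_minus_right sum_negf)
qed

text \<open>On the shifts of \<open>F\<close> by multiples of \<open>ind A\<close> the gain is linear until the slope of some
  arc across the cut \<open>A\<close> becomes an integer.\<close>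

lemma shift_along_cut:
  assumes cross: "\<And>e. e \<in> arcs G \<Longrightarrow> grad (ind A) e \<noteq> 0 \<Longrightarrow> e \<in> nonint_arcs F"
    and ex: "\<exists>e\<in>arcs G. grad (ind A) e \<noteq> 0"
    and rate: "0 \<le> cut_rate h F A"
  obtains F' where "gain h F \<le> gain h F'" "nonint_arcs F' \<subset> nonint_arcs F"
proof -
  define C where "C = {e \<in> arcs G. grad (ind A) e \<noteq> 0}"
  define k where "k e = \<lfloor>grad F e / of_int (l e)\<rfloor>" for e
  \<comment> \<open>The distance to the end of the current linear piece, measured in the direction
    in which the arc moves; the least one determines the shift.\<close>
  define room where "room e = (if grad (ind A) e = 1 then (of_int (k e) + 1) * of_int (l e) - grad F e
    else grad F e - of_int (k e) * of_int (l e))" for e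
  have k: "of_int (k e) * of_int (l e) \<le> grad F e" "grad F e \<le> (of_int (k e) + 1) * real_of_int (l e)"
    if "e \<in> arcs G" for e
    using l_pos[OF that] floor_divide_lower[of "of_int (l e)" "grad F e"]
      floor_divide_upper[of "of_int (l e)" "grad F e"] by (auto simp: k_def)
  have C: "grad (ind A) e = 1 \<or> grad (ind A) e = - 1" if "e \<in> C" for e
    using that by (auto simp: C_def split: if_splits)
  have "finite C" "C \<noteq> {}"
    using finite_arcs ex unfolding C_def by (simp, blast)
  then obtain e0 where e0: "e0 \<in> C" "\<And>e. e \<in> C \<Longrightarrow> room e0 \<le> room e"
    by (metis arg_min_if_finite(1) arg_min_least)
  define \<tau> where "\<tau> = room e0"
  have "0 \<le> \<tau>"
    using k[of e0] e0(1) by (auto simp: \<tau>_def room_def C_def)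
  define F' where "F' = F + \<tau> *\<^sub>R ind A"
  have gradF': "grad F' e = grad F e + \<tau> * grad (ind A) e" for e
    unfolding F'_def vector_add_component vector_scaleR_component real_scaleR_def
    by (simp only: algebra_simps)
  have lin: "edge_energy (l e) (grad F' e) =
      edge_energy (l e) (grad F e) + \<tau> * ((of_int (k e) + 1 / 2) * grad (ind A) e)"
    if e: "e \<in> arcs G" for e
  proof (cases "e \<in> C")
    case True
    then have "\<tau> \<le> room e"
      using e0(2) \<tau>_def by blast
    then have "of_int (k e) * of_int (l e) \<le> grad F' e"
      "grad F' e \<le> (of_int (k e) + 1) * real_of_int (l e)"
      using C[OF True] k[OF e] \<open>0 \<le> \<tau>\<close> unfolding gradF' room_def by auto
    then have "edge_energy (l e) (grad F' e) =
        edge_energy (l e) (grad F e) + (of_int (k e) + 1 / 2) * (grad F' e - grad F e)"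
      using l_pos[OF e] k[OF e] by (intro edge_energy_linear) auto
    then show ?thesis
      unfolding gradF' by (simp only: add_diff_cancel_left' mult.left_commute)
  next
    case False
    then show ?thesis
      using e unfolding gradF' by (simp add: C_def)
  qed
  have "(\<Sum>e\<in>arcs G. edge_energy (l e) (grad F' e)) = (\<Sum>e\<in>arcs G. edge_energy (l e) (grad F e)) +
      \<tau> * (\<Sum>e\<in>arcs G. (of_int (k e) + 1 / 2) * grad (ind A) e)"
    unfolding sum_distrib_left sum.distrib[symmetric] by (intro sum.cong refl lin)
  then have "energy F' = energy F + \<tau> * ((\<Sum>e\<in>arcs G. (of_int (k e) + 1 / 2) * grad (ind A) e) / 2)"
    by (simp only: energy_def add_divide_distrib times_divide_eq_right)
  then have "gain h F' = gain h F + \<tau> * cut_rate h F A"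
    unfolding gain_def cut_rate_def k_def
    by (simp only: F'_def inner_add_left inner_scaleR_left) (simp only: algebra_simps)
  then have "gain h F \<le> gain h F'"
    using \<open>0 \<le> \<tau>\<close> rate by simp
  moreover have "nonint_arcs F' \<subset> nonint_arcs F"
  proof
    \<comment> \<open>Arcs across the cut were already non-integral, and all others keep their
      difference.\<close>
    show "nonint_arcs F' \<subseteq> nonint_arcs F"
    proof
      fix e assume e: "e \<in> nonint_arcs F'"
      show "e \<in> nonint_arcs F"
      proof (cases "grad (ind A) e = 0")
        case True
        then have "grad F' e = grad F e"
          unfolding gradF' by (simp only: mult_zero_right add_0_right)
        then show ?thesis
          using e unfolding nonint_arcs_def by simp
      next
        case False
        then show ?thesis
          using cross e unfolding nonint_arcs_def by blast
      qed
    qed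
    have e0': "e0 \<in> arcs G" "e0 \<in> nonint_arcs F"
      using e0(1) cross by (auto simp: C_def)
    \<comment> \<open>The arc of least room reaches the end of its piece and becomes integral, so
      the inclusion is strict.\<close>
    have "grad F' e0 = of_int (k e0 + 1) * of_int (l e0) \<or> grad F' e0 = of_int (k e0) * of_int (l e0)"
      using C[OF e0(1)] unfolding gradF' \<tau>_def room_def by auto
    then have "grad F' e0 / of_int (l e0) = of_int (k e0 + 1) \<or> grad F' e0 / of_int (l e0) = of_int (k e0)"
      using l_pos[OF e0'(1)] by auto
    then have "grad F' e0 / of_int (l e0) \<in> \<int>"
      by (metis Ints_of_int)
    then have "e0 \<notin> nonint_arcs F'"
      unfolding nonint_arcs_def by blast
    with e0'(2) show "nonint_arcs F' \<noteq> nonint_arcs F"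
      by blast
  qed
  ultimately show ?thesis
    using that by blast
qed

lemma gain_add_const:
  assumes "h \<in> H0"
  shows "gain h (F + (\<chi> v. c)) = gain h F"
  using H0_inner_const[OF assms, of c] by (simp add: gain_def energy_def inner_add_left)

text \<open>No integral arc enters the set of vertices whose value differs from
  \<open>F $ v0\<close> by an integer, so that set is everything. Subtracting the constant
  \<open>F $ v0\<close> makes \<open>F\<close> integral without changing the gain.\<close>

lemma connected_divisible_of_int_cuts:
  assumes "h \<in> H0"
    and cut: "\<And>A. A \<noteq> {} \<Longrightarrow> A \<noteq> UNIV \<Longrightarrow>
      \<exists>e\<in>arcs G. head G e \<in> A \<and> tail G e \<notin> A \<and> e \<notin> nonint_arcs F"
  obtains f where "Digraph_Component.connected (divisible_subgraph G l f)"
    "gain h (rvec f) = gain h F"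
proof -
  obtain v0 :: 'a where True
    by simp
  have int: "\<exists>m. grad F e = of_int (m * l e)" if "e \<in> arcs G" "e \<notin> nonint_arcs F" for e
  proof -
    have "grad F e / of_int (l e) \<in> \<int>"
      using that unfolding nonint_arcs_def by blast
    then obtain m where "grad F e / of_int (l e) = of_int m"
      by (auto elim: Ints_cases)
    then have "grad F e = of_int (m * l e)"
      using l_pos[OF that(1)] by (simp add: field_simps)
    then show ?thesis ..
  qed
  define A where "A = {v. F $ v - F $ v0 \<in> \<int>}"
  have "A = UNIV"
  proof (rule ccontr)
    assume "A \<noteq> UNIV"
    moreover have "v0 \<in> A"
      by (simp add: A_def)
    ultimately obtain e where e: "e \<in> arcs G" "head G e \<in> A" "tail G e \<notin> A" "e \<notin> nonint_arcs F"
      using cut[of A] by blast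
    then have "grad F e \<in> \<int>"
      using int[of e] by auto
    moreover have "F $ tail G e - F $ v0 = F $ head G e - F $ v0 - grad F e"
      by simp
    ultimately have "tail G e \<in> A"
      using e(2) unfolding A_def by (metis Ints_diff mem_Collect_eq)
    with e(3) show False ..
  qed
  define f where "f v = \<lfloor>F $ v - F $ v0\<rfloor>" for v
  have f: "of_int (f v) = F $ v - F $ v0" for v
  proof -
    have "v \<in> A"
      using \<open>A = UNIV\<close> by simp
    then show ?thesis
      by (auto simp: A_def f_def elim: Ints_cases)
  qed
  have "rvec f + (\<chi> v. F $ v0) = F"
    by (simp add: vec_eq_iff f)
  then have gain: "gain h (rvec f) = gain h F"
    using gain_add_const[OF assms(1), of "rvec f" "F $ v0"] by simp
  interpret H: sym_graph "divisible_subgraph G l f" arev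
    by (rule sym_graph_divisible)
  have "\<exists>e\<in>arcs (divisible_subgraph G l f). head G e \<in> B \<and> tail G e \<notin> B"
    if B: "B \<noteq> {}" "B \<noteq> UNIV" for B
  proof -
    obtain e where e: "e \<in> arcs G" "head G e \<in> B" "tail G e \<notin> B" "e \<notin> nonint_arcs F"
      using cut[OF B] by blast
    obtain m where m: "grad F e = of_int (m * l e)"
      using int e by blast
    have "real_of_int (f (head G e) - f (tail G e)) = of_int (m * l e)"
      using m by (simp add: f)
    then have "f (head G e) - f (tail G e) = m * l e"
      by (simp only: of_int_eq_iff)
    then have "e \<in> arcs (divisible_subgraph G l f)"
      using e(1) by (simp add: divisible_subgraph_def)
    with e show ?thesis
      by blast
  qed
  moreover have "head (divisible_subgraph G l f) = head G" "tail (divisible_subgraph G l f) = tail G"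
    by (simp_all add: divisible_subgraph_def)
  ultimately have "Digraph_Component.connected (divisible_subgraph G l f)"
    unfolding H.connected_iff_cut by simp
  then show ?thesis
    using that gain by blast
qed

text \<open>Induction on the number of non-integral arcs: a cut met only by such arcs permits a
  shift that removes one of them; if there is no such cut, \<open>F\<close> is integral up to a
  constant.\<close>

lemma gain_le_vertex:
  assumes con: "Digraph_Component.connected G" and h: "h \<in> H0"
  shows "\<exists>f. Digraph_Component.connected (divisible_subgraph G l f) \<and> gain h F \<le> gain h (rvec f)"
proof (induction "card (nonint_arcs F)" arbitrary: F rule: less_induct)
  case less
  show ?case
  proof (cases "\<forall>A. A \<noteq> {} \<longrightarrow> A \<noteq> UNIV \<longrightarrow>
      (\<exists>e\<in>arcs G. head G e \<in> A \<and> tail G e \<notin> A \<and> e \<notin> nonint_arcs F)")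
    case True
    then obtain f where "Digraph_Component.connected (divisible_subgraph G l f)"
      "gain h (rvec f) = gain h F"
      using connected_divisible_of_int_cuts[OF h, of F] by blast
    then show ?thesis
      by (metis order_refl)
  next
    case False
    then obtain A where A: "A \<noteq> {}" "A \<noteq> UNIV"
      "\<And>e. e \<in> arcs G \<Longrightarrow> head G e \<in> A \<Longrightarrow> tail G e \<notin> A \<Longrightarrow> e \<in> nonint_arcs F"
      by blast
    \<comment> \<open>The choice of \<open>A\<close> controls only arcs entering it; reversal covers
      those leaving it.\<close>
    have rev: "arev e \<in> nonint_arcs F \<Longrightarrow> e \<in> nonint_arcs F" if "e \<in> arcs G" for e
    proof -
      have "grad F (arev e) / of_int (l (arev e)) = - (grad F e / of_int (l e))"
        using that by (simp add: head_arev tail_arev l_arev minus_divide_left)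
      then show "arev e \<in> nonint_arcs F \<Longrightarrow> e \<in> nonint_arcs F"
        using that minus_in_Ints_iff unfolding nonint_arcs_def by simp
    qed
    have cross: "e \<in> nonint_arcs F" if "e \<in> arcs G" "(head G e \<in> A) \<noteq> (tail G e \<in> A)" for e
      using that A(3)[of e] A(3)[of "arev e"] rev[of e] arev_arcs[of e] head_arev[of e] tail_arev[of e]
      by auto
    obtain e1 where e1: "e1 \<in> arcs G" "head G e1 \<in> A" "tail G e1 \<notin> A"
      using con A(1,2) connected_iff_cut by metis
    obtain B where B: "B = A \<or> B = - A" "0 \<le> cut_rate h F B"
      using cut_rate_Compl[OF h, of F A] by (metis linear neg_0_le_iff_le)
    obtain F' where F': "gain h F \<le> gain h F'" "nonint_arcs F' \<subset> nonint_arcs F"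
    proof (rule shift_along_cut[of B F h])
      show "e \<in> nonint_arcs F" if "e \<in> arcs G" "grad (ind B) e \<noteq> 0" for e
        using that B(1) by (intro cross) (auto split: if_splits)
      show "\<exists>e\<in>arcs G. grad (ind B) e \<noteq> 0"
        using e1 B(1) by (intro bexI[of _ e1]) auto
    qed (use B in auto)
    have "finite (nonint_arcs F)"
      using finite_arcs by (simp add: nonint_arcs_def)
    then have "card (nonint_arcs F') < card (nonint_arcs F)"
      using F'(2) by (rule psubset_card_mono)
    from less[OF this] F'(1) show ?thesis
      by (meson order_trans)
  qed
qed

text \<open>Writing \<open>h\<close> as a Laplacian splits the gain into a sum of edgewise terms, each of which is
  bounded above and tends to minus infinity.\<close>

lemma finite_nonneg_gains:
  assumes con: "Digraph_Component.connected G" and h: "h \<in> H0"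
  shows "finite {gain h (rvec f) | f. 0 \<le> gain h (rvec f)}"
proof -
  obtain u where u: "laplacian G u = h"
    using laplacian_surj_H0[OF con h] .
  define T where "T e t = grad u e * t - edge_energy (l e) t" for e t
  \<comment> \<open>Completing the square bounds \<open>T e\<close> by the summand at
    \<open>e\<close>, so \<open>B\<close> bounds every partial sum.\<close>
  define B where "B = (\<Sum>e\<in>arcs G. of_int (l e) * (grad u e)\<^sup>2 / 2)"
  define K where "K e = \<lceil>2 * of_int (l e) * (\<bar>grad u e\<bar> + B) + 1\<rceil>" for e
  have gain_eq: "gain h g = (\<Sum>e\<in>arcs G. T e (grad g e)) / 2" for g
    unfolding gain_def energy_def T_def u[symmetric] inner_laplacian
    by (simp add: sum_subtractf diff_divide_distrib)
  have T_le_sq: "T e t \<le> grad u e * t - t\<^sup>2 / (2 * of_int (l e))" if "e \<in> arcs G" for e t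
    using edge_energy_ge_square[of "of_int (l e)" t] l_pos[OF that] by (simp add: T_def)
  have T_le: "T e t \<le> of_int (l e) * (grad u e)\<^sup>2 / 2" if "e \<in> arcs G" for e t
  proof -
    have "0 \<le> (t - of_int (l e) * grad u e)\<^sup>2 / (2 * of_int (l e))"
      using l_pos[OF that] by simp
    also have "\<dots> = of_int (l e) * (grad u e)\<^sup>2 / 2 - (grad u e * t - t\<^sup>2 / (2 * of_int (l e)))"
      using l_pos[OF that] by (simp add: field_simps power2_eq_square)
    finally show ?thesis
      using T_le_sq[OF that, of t] by linarith
  qed
  have nn: "0 \<le> of_int (l e) * (grad u e)\<^sup>2 / 2" if "e \<in> arcs G" for e
    using l_pos[OF that] by simp
  have B: "0 \<le> B"
    unfolding B_def using nn by (rule sum_nonneg)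
  \<comment> \<open>All other terms add up to at most \<open>B\<close>, so \<open>T e t\<close> is
    at least \<open>- B\<close>. The resulting quadratic inequality is divided by
    \<open>\<bar>t\<bar>\<close> if this exceeds 1; the summand 1 covers the other case.\<close>
  have bound: "\<bar>grad g e\<bar> \<le> 2 * of_int (l e) * (\<bar>grad u e\<bar> + B) + 1"
    if e: "e \<in> arcs G" and g: "0 \<le> gain h g" for e g
  proof -
    define t where "t = grad g e"
    have l: "0 < real_of_int (l e)"
      using l_pos[OF e] by simp
    have "0 \<le> (\<Sum>e\<in>arcs G. T e (grad g e))"
      using g by (simp add: gain_eq)
    also have "\<dots> = T e t + (\<Sum>e'\<in>arcs G - {e}. T e' (grad g e'))"
      unfolding t_def using finite_arcs e by (rule sum.remove)
    also have "(\<Sum>e'\<in>arcs G - {e}. T e' (grad g e')) \<le>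
        (\<Sum>e'\<in>arcs G - {e}. of_int (l e') * (grad u e')\<^sup>2 / 2)"
      by (intro sum_mono T_le) auto
    also have "\<dots> \<le> B"
      unfolding B_def using finite_arcs nn by (intro sum_mono2) auto
    finally have "0 \<le> T e t + B"
      by simp
    then have "t\<^sup>2 / (2 * of_int (l e)) \<le> grad u e * t + B"
      using T_le_sq[OF e, of t] by linarith
    then have sq: "t\<^sup>2 \<le> 2 * of_int (l e) * (grad u e * t + B)"
      using l by (simp add: field_simps)
    show ?thesis
    proof (cases "\<bar>t\<bar> \<le> 1")
      case True
      moreover have "0 \<le> 2 * of_int (l e) * (\<bar>grad u e\<bar> + B)"
        using l B by simp
      ultimately show ?thesis
        unfolding t_def by linarith
    next
      case False
      have "grad u e * t \<le> \<bar>grad u e\<bar> * \<bar>t\<bar>"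
        by (metis abs_ge_self abs_mult)
      moreover have "B * 1 \<le> B * \<bar>t\<bar>"
        using B False by (intro mult_left_mono) auto
      ultimately have "grad u e * t + B \<le> (\<bar>grad u e\<bar> + B) * \<bar>t\<bar>"
        unfolding distrib_right by linarith
      then have "2 * of_int (l e) * (grad u e * t + B) \<le> 2 * of_int (l e) * ((\<bar>grad u e\<bar> + B) * \<bar>t\<bar>)"
        using l by (intro mult_left_mono) auto
      with sq have "\<bar>t\<bar> * \<bar>t\<bar> \<le> 2 * of_int (l e) * (\<bar>grad u e\<bar> + B) * \<bar>t\<bar>"
        by (simp only: mult.assoc abs_mult_self power2_eq_square)
      then have "\<bar>t\<bar> \<le> 2 * of_int (l e) * (\<bar>grad u e\<bar> + B)"
        using False by (auto simp only: mult_le_cancel_right)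
      then show ?thesis
        unfolding t_def by linarith
    qed
  qed
  \<comment> \<open>Constants produce infinitely many \<open>f\<close> with equal gain, so values
    are counted: they depend only on the differences along arcs, which are integers in a
    box.\<close>
  have "{gain h (rvec f) | f. 0 \<le> gain h (rvec f)} \<subseteq>
      (\<lambda>d. (\<Sum>e\<in>arcs G. T e (of_int (d e))) / 2) ` (\<Pi>\<^sub>E e\<in>arcs G. {- K e..K e})"
  proof
    fix r assume "r \<in> {gain h (rvec f) | f. 0 \<le> gain h (rvec f)}"
    then obtain f where f: "r = gain h (rvec f)" "0 \<le> gain h (rvec f)"
      by blast
    define d where "d = restrict (\<lambda>e. f (head G e) - f (tail G e)) (arcs G)"
    have "r = (\<Sum>e\<in>arcs G. T e (of_int (d e))) / 2"
      unfolding f(1) gain_eq by (simp add: d_def)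
    moreover have "d e \<in> {- K e..K e}" if "e \<in> arcs G" for e
    proof -
      have "\<bar>of_int (d e)\<bar> \<le> 2 * of_int (l e) * (\<bar>grad u e\<bar> + B) + 1"
        using bound[OF that f(2)] that by (simp add: d_def)
      also have "\<dots> \<le> of_int (K e)"
        unfolding K_def by (rule le_of_int_ceiling)
      finally have "\<bar>d e\<bar> \<le> K e"
        by linarith
      then show ?thesis
        by auto
    qed
    ultimately show "r \<in> (\<lambda>d. (\<Sum>e\<in>arcs G. T e (of_int (d e))) / 2) ` (\<Pi>\<^sub>E e\<in>arcs G. {- K e..K e})"
      by (intro image_eqI[of _ _ d]) (auto simp: d_def)
  qed
  then show ?thesis
    by (rule finite_subset) (intro finite_imageI finite_PiE finite_arcs; simp)
qed

text \<open>The zero function has gain 0, so some integral \<open>f\<close> with connected subgraph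
  has nonnegative gain. The largest such gain is attained and, by \<open>gain_le_vertex\<close>,
  dominates all real functions.\<close>

lemma VorH_cover:
  assumes con: "Digraph_Component.connected G" and h: "h \<in> H0"
  obtains f where "Digraph_Component.connected (divisible_subgraph G l f)" "h \<in> VorH G arev l f"
proof -
  let ?P = "\<lambda>f. Digraph_Component.connected (divisible_subgraph G l f)"
  let ?S = "{gain h (rvec f) | f. ?P f \<and> 0 \<le> gain h (rvec f)}"
  have fin: "finite ?S"
    by (rule finite_subset[OF _ finite_nonneg_gains[OF con h]]) blast
  have "gain h 0 = 0"
    using edge_energy_at_multiple[of _ 0] l_pos by (simp add: gain_def energy_def)
  then have "?S \<noteq> {}"
    using gain_le_vertex[OF con h, of 0] by auto
  then have "Max ?S \<in> ?S"
    using fin by (rule Max_in[rotated])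
  then obtain f where f: "?P f" "0 \<le> gain h (rvec f)" "Max ?S = gain h (rvec f)"
    by blast
  have "gain h g \<le> gain h (rvec f)" for g
  proof -
    obtain f' where f': "?P f'" "gain h g \<le> gain h (rvec f')"
      using gain_le_vertex[OF con h] by blast
    show ?thesis
    proof (cases "0 \<le> gain h (rvec f')")
      case True
      then have "gain h (rvec f') \<le> Max ?S"
        using f'(1) fin by (intro Max_ge) auto
      then show ?thesis
        using f'(2) f(3) by linarith
    next
      case False
      then show ?thesis
        using f'(2) f(2) by linarith
    qed
  qed
  then show ?thesis
    using that f(1) mem_VorH_of_gain_max by blast
qed

end

section \<open>Voronoi cells and the tiling\<close>

context sym_graph
begin

text \<open>With all lengths 1 and \<open>f = 0\<close>, every arc is divisible and every slope is
  0, so the cell is the zonotope itself. The Voronoi inequalities say that 0 has maximal gain among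
  integral functions.\<close>

lemma VorO_eq_zonotope:
  assumes con: "Digraph_Component.connected G"
  shows "VorO G = zonotope G"
proof -
  interpret M: metric_graph G arev "\<lambda>_. 1"
    by unfold_locales auto
  have Z: "VorH G arev (\<lambda>_. 1) (\<lambda>_. 0) = zonotope G"
    unfolding M.VorH_eq_translated_zonotope
    by (simp add: coboundary_adj_def slope_def zonotope_def divisible_subgraph_def
        zero_vec_def[symmetric] cong: if_cong)
  have energy: "2 * M.energy (M.rvec g) = M.rvec g \<bullet> laplacian G (M.rvec g)" for g
  proof -
    have "edge_energy 1 (grad (M.rvec g) e) = (grad (M.rvec g) e)\<^sup>2 / 2" for e
      using edge_energy_at_multiple[of 1 "g (head G e) - g (tail G e)"] by simp
    then show ?thesis
      unfolding M.energy_def inner_laplacian of_int_1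
      by (simp only: power2_eq_square sum_divide_distrib[symmetric])
  qed
  have "h \<in> VorO G \<longleftrightarrow> h \<in> VorH G arev (\<lambda>_. 1) (\<lambda>_. 0)" if h: "h \<in> H0" for h
  proof -
    obtain u where u: "laplacian G u = h"
      using laplacian_surj_H0[OF con h] .
    have form: "laplacian_form G (h - laplacian G g) = laplacian_form G h - 2 * (g \<bullet> h) + g \<bullet> laplacian G g"
      for g
    proof -
      have "h - laplacian G g = laplacian G (u - g)"
        using linear_diff[OF linear_laplacian] u by simp
      then have "laplacian_form G (h - laplacian G g) = (u - g) \<bullet> (h - laplacian G g)"
        by (simp add: laplacian_form_laplacian)
      moreover have "u \<bullet> laplacian G g = g \<bullet> h"
        using inner_laplacian_commute u by metis
      moreover have "laplacian_form G h = u \<bullet> h"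
        using laplacian_form_laplacian[of u] u by simp
      ultimately show ?thesis
        by (simp add: inner_diff_left inner_diff_right)
    qed
    have gain0: "M.gain h (M.rvec (\<lambda>_. 0)) = 0"
      using edge_energy_at_multiple[of 1 0] by (simp add: M.gain_def M.energy_def inner_vec_def)
    have "h \<in> VorO G \<longleftrightarrow> (\<forall>g. 2 * (M.rvec g \<bullet> h) \<le> 2 * M.energy (M.rvec g))"
      using h form by (simp add: VorO_def voronoi_cell_origin_def laplacian_lattice_def energy)
    also have "\<dots> \<longleftrightarrow> (\<forall>g. M.gain h (M.rvec g) \<le> M.gain h (M.rvec (\<lambda>_. 0)))"
      unfolding gain0 by (simp add: M.gain_def)
    also have "\<dots> \<longleftrightarrow> h \<in> VorH G arev (\<lambda>_. 1) (\<lambda>_. 0)"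
    proof
      assume le: "\<forall>g. M.gain h (M.rvec g) \<le> M.gain h (M.rvec (\<lambda>_. 0))"
      \<comment> \<open>The inequalities test only integral functions; the covering provides an
        integral maximiser over all real ones, and 0 does at least as well.\<close>
      obtain f where "h \<in> VorH G arev (\<lambda>_. 1) f"
        using M.VorH_cover[OF con h] by blast
      then show "h \<in> VorH G arev (\<lambda>_. 1) (\<lambda>_. 0)"
        using le M.mem_VorH_iff by (meson order_trans)
    qed (use M.gain_le_of_mem_VorH in blast)
    finally show ?thesis .
  qed
  moreover have "VorO G \<subseteq> H0"
    by (auto simp: VorO_def voronoi_cell_origin_def)
  ultimately show ?thesis
    using M.VorH_subset_H0 Z by blast
qed

end

context metric_graph
begin

section \<open>The tiling and its top-dimensional cells\<close>

lemma VorH_congruent_VorO: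
  assumes "Digraph_Component.connected (divisible_subgraph G l f)"
  shows "translation_congruent (VorH G arev l f) (VorO (divisible_subgraph G l f))"
  unfolding translation_congruent_def VorH_eq_translated_zonotope
    sym_graph.VorO_eq_zonotope[OF sym_graph_divisible assms] by blast

lemma spanning_divisible: "spanning (divisible_subgraph G l f) G"
  unfolding spanning_def subgraph_def compatible_def
  by (auto simp: divisible_subgraph_def verts_UNIV intro!: wf_digraph.intro)

text \<open>Two tiles are faces of cells that meet in a common face, and
  \<open>face_of_Int_subface\<close> transfers this to the tiles.\<close>

lemma polytope_tiling_Vor_tiling:
  assumes "Digraph_Component.connected G"
  shows "polytope_tiling (Vor_tiling G arev l) H0"
  unfolding polytope_tiling_def
proof (intro conjI ballI allI impI)
  fix P assume P: "P \<in> Vor_tiling G arev l"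
  then show "polytope P" "P \<noteq> {}"
    using face_of_polytope_polytope polytope_VorH by (auto simp: Vor_tiling_def)
  show "F \<in> Vor_tiling G arev l" if "F face_of P \<and> F \<noteq> {}" for F
    using that P face_of_trans by (auto simp: Vor_tiling_def)
  fix Q assume Q: "Q \<in> Vor_tiling G arev l"
  obtain f f' where "P face_of VorH G arev l f" "Q face_of VorH G arev l f'"
    using P Q by (auto simp: Vor_tiling_def)
  moreover have "VorH G arev l f \<inter> VorH G arev l f' face_of VorH G arev l f'"
    using VorH_Int_face[of f' f] by (simp add: Int_commute)
  ultimately show "P \<inter> Q face_of P" "P \<inter> Q face_of Q"
    using face_of_Int_subface[OF VorH_Int_face] by blast+
next
  show "\<Union> (Vor_tiling G arev l) = H0"
  proof (intro equalityI subsetI)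
    fix h :: "real^'a" assume "h \<in> \<Union> (Vor_tiling G arev l)"
    then show "h \<in> H0"
      using face_of_imp_subset VorH_subset_H0 by (fastforce simp: Vor_tiling_def)
  next
    fix h :: "real^'a" assume "h \<in> H0"
    then obtain f where "Digraph_Component.connected (divisible_subgraph G l f)" "h \<in> VorH G arev l f"
      using VorH_cover[OF assms] by blast
    moreover from this have "VorH G arev l f \<in> Vor_tiling G arev l"
      using VorH_nonempty face_of_refl[OF polytope_imp_convex[OF polytope_VorH]]
      by (auto simp: Vor_tiling_def)
    ultimately show "h \<in> \<Union> (Vor_tiling G arev l)"
      by blast
  qed
qed

text \<open>Every cell has the dimension of \<open>H0\<close>, while a proper face has a smaller
  one.\<close>

lemma top_cells_Vor_tiling:
  "top_cells (Vor_tiling G arev l) H0 =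
     {VorH G arev l f | f. Digraph_Component.connected (divisible_subgraph G l f)}"
proof (intro equalityI subsetI)
  fix P assume "P \<in> top_cells (Vor_tiling G arev l) H0"
  then obtain f where f: "Digraph_Component.connected (divisible_subgraph G l f)"
    "P face_of VorH G arev l f" "aff_dim P = aff_dim (H0 :: (real^'a) set)"
    by (auto simp: top_cells_def Vor_tiling_def)
  then have "P = VorH G arev l f"
    using face_of_aff_dim_lt[OF polytope_imp_convex[OF polytope_VorH] f(2)] aff_dim_VorH[OF f(1)]
    by fastforce
  with f(1) show "P \<in> {VorH G arev l f | f. Digraph_Component.connected (divisible_subgraph G l f)}"
    by blast
next
  fix P assume "P \<in> {VorH G arev l f | f. Digraph_Component.connected (divisible_subgraph G l f)}"
  then show "P \<in> top_cells (Vor_tiling G arev l) H0"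
    using VorH_nonempty face_of_refl[OF polytope_imp_convex[OF polytope_VorH]] aff_dim_VorH
    by (auto simp: top_cells_def Vor_tiling_def)
qed

end

theorem theorem4p15:
  fixes G :: "('v::finite, 'e) pre_digraph" and arev :: "'e \<Rightarrow> 'e" and l :: "'e \<Rightarrow> int"
  assumes "bidirected_digraph G arev"
    and "fin_digraph G"
    and "loopfree_digraph G"
    and "verts G = UNIV"
    and "Digraph_Component.connected G"
    and "\<forall>e\<in>arcs G. 0 < l e \<and> l (arev e) = l e"
  shows "polytope_tiling (Vor_tiling G arev l) H0 \<and>
    top_cells (Vor_tiling G arev l) H0 =
      {VorH G arev l f | f. Digraph_Component.connected (divisible_subgraph G l f)} \<and>
    (\<forall>P \<in> top_cells (Vor_tiling G arev l) H0.
       \<exists>G'. spanning G' G \<and> arev ` arcs G' \<subseteq> arcs G' \<and> Digraph_Component.connected G' \<and>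
         translation_congruent P (VorO G')) \<and>
    (\<forall>f :: 'v \<Rightarrow> int. Digraph_Component.connected (divisible_subgraph G l f) \<longrightarrow>
       translation_congruent (VorH G arev l f) (VorO (divisible_subgraph G l f)))"
proof -
  interpret bidirected_digraph G arev
    by (rule assms(1))
  interpret M: metric_graph G arev l
    using assms fin_digraph.finite_arcs[OF assms(2)]
    by unfold_locales (auto simp: arev_in_arcs)
  have "\<exists>G'. spanning G' G \<and> arev ` arcs G' \<subseteq> arcs G' \<and> Digraph_Component.connected G' \<and>
      translation_congruent P (VorO G')" if P: "P \<in> top_cells (Vor_tiling G arev l) H0" for P
  proof -
    obtain f where f: "P = VorH G arev l f" "Digraph_Component.connected (divisible_subgraph G l f)"
      using P unfolding M.top_cells_Vor_tiling by blast
    have "arev ` arcs (divisible_subgraph G l f) \<subseteq> arcs (divisible_subgraph G l f)"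
      using sym_graph.arev_arcs[OF M.sym_graph_divisible] by blast
    then show ?thesis
      using f M.spanning_divisible M.VorH_congruent_VorO by blast
  qed
  then show ?thesis
    using M.polytope_tiling_Vor_tiling[OF assms(5)] M.top_cells_Vor_tiling M.VorH_congruent_VorO
    by blast
qed

end
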